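(* Let $\mathbf{B} = \mathrm{Av}(321\mid 21)$ and, for $n\ge 0$, let $b_n$ be the number of permutations of length $n$ in $\mathbf{B}$. Then the generating function $s_{\mathbf{B}}(z)=\sum_{n\ge 0} b_n z^n$ is $$s_{\mathbf{B}}(z) = -\frac{1-\sqrt{1-4z} + z\left(-4+\sqrt{1-4z} + \sqrt{1-5z}/\sqrt{1-z}\right)}{2z^2}.$$
   Context: Permutations are written in one-line notation. A permutation (or a sequence of distinct integers) contains a permutation $\tau$ of length $k$ as a pattern if it has a (not necessarily contiguous) subsequence of length $k$ whose entries are in the same relative order as those of $\tau$; otherwise it avoids $\tau$. For a permutation $\alpha$ of length three and a permutation $\beta$ of length two, the juxtaposition class $\mathrm{Av}(\alpha\mid\beta)$ is the set of all permutations $\pi$ whose one-line notation can be written as a concatenation $\pi = AB$ of two (possibly empty) contiguous blocks, such that the prefix $A$ avoids $\alpha$ and the suffix $B$ avoids $\beta$. Thus $\mathrm{Av}(321\mid 21)$ consists of the permutations that are a $321$-avoiding prefix followed by an increasing suffix. Each permutation is counted once, regardless of how many such decompositions it has. The empty permutation (length $0$) is included, so the constant term of the generating function is $1$. Square roots denote the formal power series in $z$ with constant term $1$, and the identity is one of formal power series. *)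

theory Defs
  imports
    "HOL-Computational_Algebra.Computational_Algebra"
    "HOL-Combinatorics.Combinatorics"
    "HOL-Library.Sublist"
begin

definition order_isomorphic :: "nat list \<Rightarrow> nat list \<Rightarrow> bool" where
  "order_isomorphic xs ys \<longleftrightarrow>
     length xs = length ys \<and>
     (\<forall>i < length xs. \<forall>j < length xs. xs ! i < xs ! j \<longleftrightarrow> ys ! i < ys ! j)"

definition contains_pattern :: "nat list \<Rightarrow> nat list \<Rightarrow> bool" where
  "contains_pattern xs \<tau> \<longleftrightarrow> (\<exists>ys. subseq ys xs \<and> order_isomorphic ys \<tau>)"

definition avoids :: "nat list \<Rightarrow> nat list \<Rightarrow> bool" where
  "avoids xs \<tau> \<longleftrightarrow> \<not> contains_pattern xs \<tau>"

text \<open>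
  A permutation of length \<open>n\<close> is given by its one-line notation, a list containing each of
  \<open>1, \<dots>, n\<close> exactly once. The blocks of a juxtaposition are factors of this list and are not
  renumbered.
\<close>

definition Av_juxt :: "nat list \<Rightarrow> nat list \<Rightarrow> nat list set" where
  "Av_juxt \<alpha> \<beta> =
     {\<pi>. \<pi> \<in> permutations_of_set {1..length \<pi>} \<and>
         (\<exists>A B. \<pi> = A @ B \<and> avoids A \<alpha> \<and> avoids B \<beta>)}"

definition class_count :: "nat list set \<Rightarrow> nat \<Rightarrow> nat" where
  "class_count C n = card {\<pi> \<in> C. length \<pi> = n}"

definition class_gf :: "nat list set \<Rightarrow> real fps" where
  "class_gf C = Abs_fps (\<lambda>n. real (class_count C n))"

lemma finite_Av_juxt_length: "finite {\<pi> \<in> Av_juxt \<alpha> \<beta>. length \<pi> = n}"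
  by (rule finite_subset[of _ "permutations_of_set {1..n}"]) (auto simp: Av_juxt_def)

definition fps_sqrt :: "real fps \<Rightarrow> real fps" where
  "fps_sqrt f = fps_radical root 2 f"

text \<open>
  For a series with constant term \<open>1\<close>, this is the unique square root with constant term \<open>1\<close>.
\<close>

lemma fps_sqrt_unique:
  assumes "fps_nth f 0 = 1"
  shows "g = fps_sqrt f \<longleftrightarrow> g ^ 2 = f \<and> fps_nth g 0 = 1"
proof -
  have "fps_sqrt f ^ 2 = f"
    using power_radical[of f root 1] assms by (simp add: fps_sqrt_def numeral_2_eq_2)
  moreover have "fps_nth (fps_sqrt f) 0 = 1"
    using assms by (simp add: fps_sqrt_def)
  moreover have "g = fps_sqrt f" if "g ^ 2 = f" "fps_nth g 0 = 1"
    using radical_unique[of root 1 f g] that assms by (simp add: fps_sqrt_def numeral_2_eq_2)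
  ultimately show ?thesis by blast
qed

lemma fps_sqrt_nth_1:
  assumes "fps_nth f 0 = 1"
  shows "fps_nth (fps_sqrt f) 1 = fps_nth f 1 / 2"
proof -
  have sq: "fps_sqrt f ^ 2 = f" and c: "fps_nth (fps_sqrt f) 0 = 1"
    using fps_sqrt_unique[OF assms, of "fps_sqrt f"] by auto
  have "fps_nth (fps_sqrt f ^ 2) 1 = 2 * fps_nth (fps_sqrt f) 1"
    using c by (simp add: power2_eq_square fps_mult_nth)
  then show ?thesis using sq by simp
qed

text \<open>
  Division of formal power series by \<open>2 * fps_X\<^sup>2\<close> drops the coefficients of order below \<open>2\<close>.
  Here there are none, so the quotient is exact.
\<close>

lemma numerator_dvd:
  defines "N \<equiv> 1 - fps_sqrt (1 - 4 * fps_X)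
                + fps_X * (- 4 + fps_sqrt (1 - 4 * fps_X)
                           + fps_sqrt (1 - 5 * fps_X) / fps_sqrt (1 - fps_X))"
  shows "2 * fps_X ^ 2 dvd N"
proof -
  have s0: "fps_nth (fps_sqrt f) 0 = 1" if "fps_nth f 0 = 1" for f
    using fps_sqrt_unique[OF that, of "fps_sqrt f"] by auto
  have s1: "fps_nth (fps_sqrt (1 - 4 * fps_X)) 1 = - 2"
    by (subst fps_sqrt_nth_1) (simp_all add: numeral_fps_const)
  have q: "fps_nth (fps_sqrt (1 - 5 * fps_X) / fps_sqrt (1 - fps_X)) 0 = 1"
    by (simp add: fps_divide_unit s0)
  have "fps_nth N 0 = 0"
    by (simp add: N_def s0)
  moreover have "fps_nth N 1 = 0"
    using q s1 by (simp add: N_def s0 fps_numeral_nth)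
  ultimately have "fps_nth N n = 0" if "n < 2" for n
    using that by (auto simp: less_2_cases_iff)
  moreover have "Suc (Suc (n - 2)) = n" if "\<not> n < 2" for n :: nat
    using that by arith
  ultimately have "N = fps_X ^ 2 * fps_shift 2 N"
    by (intro fps_ext) (simp add: fps_X_power_mult_nth)
  also have "\<dots> = 2 * fps_X ^ 2 * (fps_const (1/2) * fps_shift 2 N)"
  proof -
    have "(2 :: real fps) * fps_const (1/2) = 1"
      by (simp add: numeral_fps_const fps_const_mult)
    then have "fps_X ^ 2 * fps_shift 2 N = (2 * fps_const (1/2)) * (fps_X ^ 2 * fps_shift 2 N)"
      by (simp only: mult_1)
    then show ?thesis
      by (simp only: mult_ac)
  qed
  finally show ?thesis by (rule dvdI)
qed

end

theory Submission
  imports Defs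
begin

text \<open>
  A split of a permutation \<open>\<pi>\<close> is a factorisation \<open>\<pi> = A @ B\<close> with \<open>A\<close> avoiding \<open>321\<close> and \<open>B\<close>
  increasing. Splits are easy to count: the set of values of \<open>A\<close> is arbitrary and determines
  \<open>B\<close>, so there are \<open>\<Sum>k. (n choose k) * C\<^sub>k\<close> of them, where \<open>C\<^sub>k\<close> is the number of \<open>321\<close>-avoiding
  permutations of length \<open>k\<close>. A permutation may have several splits, and each of them but the one
  with the longest \<open>A\<close> has the form \<open>A @ x # B\<close> with \<open>A @ [x]\<close> still avoiding \<open>321\<close>. Such a
  permutation avoids \<open>321\<close> altogether (\<open>avoids_321_append_increasing\<close>). Hence the number of
  permutations in the class is the number of splits minus the number of \<open>321\<close>-avoiding
  permutations with a marked nonempty increasing suffix (\<open>class_count_eq\<close>).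

  Marked suffixes drive the recursion for \<open>321\<close>-avoiders as well: a new maximum may be inserted
  exactly in front of an increasing suffix. Counting by the length \<open>j\<close> of the marked suffix and
  inserting the maximum gives a recursion that is solved by the powers of \<open>W = z * C(z)\<close>
  (\<open>catalan_gf\<close>), because \<open>W\<^sup>2 = W - z\<close>: there are \<open>[z\<^bsup>n+1\<^esup>] W\<^bsup>j+1\<^esup>\<close> marked permutations
  (\<open>card_marked_eq_coeff\<close>). Summing over \<open>j \<ge> 1\<close> telescopes to \<open>[z\<^bsup>n+2\<^esup>] W\<^sup>3\<close>. The splits have
  generating function \<open>V / z\<close> with \<open>V(z) = W(z / (1 - z))\<close> (\<open>split_gf\<close>), and
  \<open>(1 - 2 * V)\<^sup>2 = (1 - 5 * z) / (1 - z)\<close>.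
  So the answer is \<open>(z * V - W\<^sup>3) / z\<^sup>2\<close>, where \<open>W\<close> and \<open>V\<close> contribute the two kinds of square roots.
\<close>

section \<open>Avoiding 321 and 21\<close>

lemma sorted_iff_no_descent:
  fixes xs :: "nat list"
  shows "sorted xs \<longleftrightarrow> (\<forall>b a. subseq [b, a] xs \<longrightarrow> \<not> a < b)"
proof (induction xs)
  case (Cons x xs)
  have "subseq [b, a] (x # xs) \<longleftrightarrow> b = x \<and> a \<in> set xs \<or> subseq [b, a] xs" for b a
    using subseq_Cons'[of b "[a]" xs] by (auto simp: subseq_singleton_left)
  then show ?case
    using Cons.IH by (auto simp: not_less)
qed simp

lemma avoids_21_iff_sorted: "avoids xs [2, 1] \<longleftrightarrow> sorted xs"
proof -
  have "order_isomorphic ys [2, 1] \<longleftrightarrow> (\<exists>b a. ys = [b, a] \<and> a < b)" for ys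
  proof (cases "length ys = 2")
    case True
    then obtain b a where "ys = [b, a]" by (auto simp: length_Suc_conv numeral_2_eq_2)
    then show ?thesis by (simp add: order_isomorphic_def All_less_Suc) auto
  qed (auto simp: order_isomorphic_def)
  then have "contains_pattern xs [2, 1] \<longleftrightarrow> (\<exists>b a. subseq [b, a] xs \<and> a < b)"
    unfolding contains_pattern_def by (simp only:) blast
  then show ?thesis
    unfolding avoids_def sorted_iff_no_descent by simp
qed

definition avoids_321 :: "nat list \<Rightarrow> bool" where
  "avoids_321 xs \<longleftrightarrow> (\<forall>c b a. subseq [c, b, a] xs \<longrightarrow> b < c \<longrightarrow> \<not> a < b)"

lemma avoids_321_iff: "avoids xs [3, 2, 1] \<longleftrightarrow> avoids_321 xs"
proof -
  have "order_isomorphic ys [3, 2, 1] \<longleftrightarrow> (\<exists>c b a. ys = [c, b, a] \<and> b < c \<and> a < b)" for ys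
  proof (cases "length ys = 3")
    case True
    then obtain c b a where "ys = [c, b, a]" by (auto simp: length_Suc_conv numeral_3_eq_3)
    then show ?thesis by (simp add: order_isomorphic_def All_less_Suc) auto
  qed (auto simp: order_isomorphic_def)
  then have "contains_pattern xs [3, 2, 1] \<longleftrightarrow> (\<exists>c b a. subseq [c, b, a] xs \<and> b < c \<and> a < b)"
    unfolding contains_pattern_def by (simp only:) blast
  then show ?thesis
    unfolding avoids_def avoids_321_def by blast
qed

lemma set_mono_subseq: "subseq xs ys \<Longrightarrow> set xs \<subseteq> set ys"
  by (auto simp: subseq_conv_nths dest: in_set_nthsD)

lemma avoids_321_subseq: "avoids_321 ys \<Longrightarrow> subseq xs ys \<Longrightarrow> avoids_321 xs"
  unfolding avoids_321_def using subseq_order.order_trans by blast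

text \<open>
  The maximum \<open>m\<close> can only play the role of the 3, and then the 2 and the 1 form a descent behind it.
\<close>

lemma avoids_321_insert_max:
  assumes "\<forall>x \<in> set (A @ E). x < m"
  shows "avoids_321 (A @ m # E) \<longleftrightarrow> avoids_321 (A @ E) \<and> sorted E"
proof (intro iffI conjI)
  assume av: "avoids_321 (A @ m # E)"
  show "avoids_321 (A @ E)"
    by (rule avoids_321_subseq[OF av]) (simp only: subseq_append' list_emb_Cons subseq_order.order_refl)
  have "\<not> a < b" if ba: "subseq [b, a] E" for b a
  proof -
    have "b \<in> set E"
      using set_mono_subseq[OF ba] by simp
    then have "b < m" using assms by simp
    moreover have "subseq [m, b, a] (A @ m # E)"
      using ba by (intro subseq_drop_many) simp
    ultimately show ?thesis
      using av by (auto simp: avoids_321_def)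
  qed
  then show "sorted E"
    unfolding sorted_iff_no_descent by blast
next
  assume *: "avoids_321 (A @ E) \<and> sorted E"
  show "avoids_321 (A @ m # E)"
    unfolding avoids_321_def
  proof (intro allI impI notI)
    fix c b a
    assume sub: "subseq [c, b, a] (A @ m # E)" and "b < c" "a < b"
    have "c \<in> set (A @ m # E)"
      using set_mono_subseq[OF sub] by simp
    then have "c \<le> m" using assms by (auto intro: less_imp_le)
    then have ne: "b \<noteq> m" "a \<noteq> m" using \<open>b < c\<close> \<open>a < b\<close> by auto
    have filt: "filter (\<lambda>x. x \<noteq> m) (A @ m # E) = A @ E"
    proof -
      have "filter (\<lambda>x. x \<noteq> m) xs = xs" if "set xs \<subseteq> set (A @ E)" for xs
        using that assms by (intro filter_True) blast
      then show ?thesis by simp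
    qed
    show False
    proof (cases "c = m")
      case True
      have "subseq ([m] @ [b, a]) (A @ m # E)" using sub True by simp
      moreover have "m \<notin> set A" using assms by auto
      ultimately have "subseq [b, a] E"
        by (induction A) (auto split: if_splits)
      then show False
        using * \<open>a < b\<close> sorted_iff_no_descent by blast
    next
      case False
      have "subseq (filter (\<lambda>x. x \<noteq> m) [c, b, a]) (A @ E)"
        using subseq_filter[OF sub, of "\<lambda>x. x \<noteq> m"] unfolding filt .
      then show False
        using * ne False \<open>b < c\<close> \<open>a < b\<close> by (auto simp: avoids_321_def)
    qed
  qed
qed

text \<open>
  Everything behind \<open>x\<close> is at least \<open>x\<close>. If a pattern 321 used an entry of \<open>B\<close>, this entry could
  only be its 1, and then \<open>x\<close> could replace it, giving a pattern inside \<open>A @ [x]\<close>.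
\<close>

lemma avoids_321_append_increasing:
  assumes "avoids_321 (A @ [x])" "sorted (x # B)"
  shows "avoids_321 (A @ x # B)"
  unfolding avoids_321_def
proof (intro allI impI notI)
  fix c b a
  assume sub: "subseq [c, b, a] (A @ x # B)" and "b < c" "a < b"
  have "subseq [c, b, a] ((A @ [x]) @ B)" using sub by simp
  then obtain us vs where uv: "[c, b, a] = us @ vs" "subseq us (A @ [x])" "subseq vs B"
    by (rule subseq_appendE)
  have B: "\<not> subseq [b, a] B"
    using assms(2) \<open>a < b\<close> sorted_iff_no_descent[of B] by auto
  have "us \<in> set (prefixes [c, b, a])"
    unfolding in_set_prefixes prefix_def using uv(1) by blast
  then have us: "us = [] \<or> us = [c] \<or> us = [c, b] \<or> us = [c, b, a]" by simp
  consider "us = []" | "us = [c]" | "us = [c, b]" "vs = [a]" | "us = [c, b, a]"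
    using us
  proof (elim disjE)
    assume "us = [c, b]"
    moreover from this have "vs = [a]" using uv(1) by simp
    ultimately show ?thesis by (rule that(3))
  qed (erule that)+
  then show False
  proof cases
    case 1
    then have "subseq [c, b, a] B" using uv by simp
    then show False using B by (blast dest: subseq_Cons')
  next
    case 2
    then show False using uv B by simp
  next
    case 3
    then have "a \<in> set B" using uv(3) by (simp add: subseq_singleton_left)
    then have "x \<le> a" using assms(2) by simp
    have "subseq [c, b] A"
    proof -
      obtain ps qs where p: "[c, b] = ps @ qs" "subseq ps A" "subseq qs [x]"
        using uv(2) 3 by (metis subseq_appendE)
      have "b \<notin> set qs"
        using set_mono_subseq[OF p(3)] \<open>x \<le> a\<close> \<open>a < b\<close> by auto
      then have "qs = []"
        using p(1) by (cases qs rule: rev_cases) auto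
      then show ?thesis using p by simp
    qed
    then have "subseq ([c, b] @ [x]) (A @ [x])" by (simp only: subseq_append)
    then show False
      using assms(1) \<open>x \<le> a\<close> \<open>a < b\<close> \<open>b < c\<close> unfolding avoids_321_def
      by (metis append_Cons append_Nil le_less_trans)
  next
    case 4
    then show False
      using uv(2) assms(1) \<open>a < b\<close> \<open>b < c\<close> unfolding avoids_321_def by blast
  qed
qed

section \<open>Splits and marked increasing suffixes\<close>

text \<open>
  Permutations of arbitrary finite sets are used throughout: removing an entry then needs no
  renumbering, and the prefix of a split is again such a permutation.
\<close>

definition marked :: "nat set \<Rightarrow> (nat list \<times> nat list) set" where
  "marked X = {(A, E). A @ E \<in> permutations_of_set X \<and> avoids_321 (A @ E) \<and> sorted E}"

definition splits :: "nat set \<Rightarrow> (nat list \<times> nat list) set" where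
  "splits X = {(A, B). A @ B \<in> permutations_of_set X \<and> avoids_321 A \<and> sorted B}"

lemma finite_splits [simp]: "finite (splits X)"
proof (rule finite_subset)
  show "splits X \<subseteq> (\<lambda>(\<pi>, k). (take k \<pi>, drop k \<pi>)) ` (permutations_of_set X \<times> {..card X})"
  proof (clarify)
    fix A B assume *: "(A, B) \<in> splits X"
    show "(A, B) \<in> (\<lambda>(\<pi>, k). (take k \<pi>, drop k \<pi>)) ` (permutations_of_set X \<times> {..card X})"
      using * length_finite_permutations_of_set[of "A @ B" X]
      by (intro image_eqI[of _ _ "(A @ B, length A)"]) (auto simp: splits_def)
  qed
qed auto

lemma marked_subset_splits: "marked X \<subseteq> splits X"
  unfolding marked_def splits_def
  using avoids_321_subseq subseq_rev_drop_many[OF subseq_order.order_refl] by blast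

lemma finite_marked [simp]: "finite (marked X)"
  using marked_subset_splits finite_splits by (rule finite_subset)

lemma length_marked: "(A, E) \<in> marked X \<Longrightarrow> length A + length E = card X"
  by (auto simp: marked_def dest: length_finite_permutations_of_set)

text \<open>
  Remove the maximum \<open>m\<close> from a permutation with a marked increasing suffix of length \<open>Suc i\<close>. If \<open>m\<close>
  lies in the suffix, it is its last entry and a marked suffix of length \<open>i\<close> remains. Otherwise
  everything behind \<open>m\<close> is increasing; marking all of it records the place of \<open>m\<close>, and the length is
  at least \<open>Suc i\<close>. So the length of the remaining mark tells the two cases apart.
\<close>

lemma card_marked_insert_max:
  assumes m: "\<forall>x \<in> X. x < m"
  shows "card {(A, E) \<in> marked (insert m X). length E = Suc i} =
         card {(A, E) \<in> marked X. length E \<ge> i}"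
proof -
  define f where "f = (\<lambda>(A :: nat list, E). if length E = i then (A, E @ [m])
      else (A @ m # take (length E - Suc i) E, drop (length E - Suc i) E))"
  \<comment> \<open>The inverse of \<open>f\<close>: remove \<open>m\<close> and, if it was not in the suffix, extend the mark to its place.\<close>
  define g where "g = (\<lambda>(A, E). if m \<in> set E then (A, butlast E)
      else (takeWhile (\<lambda>x. x \<noteq> m) A, tl (dropWhile (\<lambda>x. x \<noteq> m) A) @ E))"
  have "bij_betw f {(A, E) \<in> marked X. length E \<ge> i}
          {(A, E) \<in> marked (insert m X). length E = Suc i}"
  proof (rule bij_betw_byWitness[where f' = g])
    show "\<forall>p \<in> {(A, E) \<in> marked X. length E \<ge> i}. g (f p) = p"
    proof clarify
      fix A E assume "(A, E) \<in> marked X" "length E \<ge> i"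
      then have "set (A @ E) = X" by (simp add: marked_def permutations_of_set_def)
      with m have mA: "m \<notin> set A" "m \<notin> set E" by auto
      then have [simp]: "takeWhile (\<lambda>x. x \<noteq> m) (A @ m # xs) = A"
                "dropWhile (\<lambda>x. x \<noteq> m) (A @ m # xs) = m # xs" for xs
        by (induction A) auto
      show "g (f (A, E)) = (A, E)"
        using mA by (auto simp: f_def g_def dest: in_set_dropD)
    qed
  next
    show "\<forall>p \<in> {(A, E) \<in> marked (insert m X). length E = Suc i}. f (g p) = p"
    proof clarify
      fix A E assume AE: "(A, E) \<in> marked (insert m X)" "length E = Suc i"
      have st: "set (A @ E) = insert m X" "distinct (A @ E)" "sorted E" 
        using AE by (simp_all add: marked_def permutations_of_set_def)
      show "f (g (A, E)) = (A, E)"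
      proof (cases "m \<in> set E")
        case True
        then obtain E' y where E': "E = E' @ [y]" by (cases E rule: rev_cases) auto
        have "\<forall>x \<in> set (A @ E). x \<le> m" using st(1) m by (auto intro: less_imp_le)
        then have "y = m"
          using True E' st(3) by (auto simp: sorted_append intro: antisym)
        then show ?thesis using True E' AE by (simp add: f_def g_def)
      next
        case False
        then have "m \<in> set A" using st by auto
        then obtain A1 A2 where "A = A1 @ m # A2" "m \<notin> set A1"
          by (meson split_list_first)
        moreover have "takeWhile (\<lambda>x. x \<noteq> m) (A1 @ m # A2) = A1"
                "dropWhile (\<lambda>x. x \<noteq> m) (A1 @ m # A2) = m # A2"
          using \<open>m \<notin> set A1\<close> by (induction A1) auto
        ultimately show ?thesis
          using False AE(2) by (simp add: f_def g_def)
      qed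
    qed
  next
    show "f ` {(A, E) \<in> marked X. length E \<ge> i}
        \<subseteq> {(A, E) \<in> marked (insert m X). length E = Suc i}"
    proof (intro image_subsetI)
      fix p assume "p \<in> {(A, E) \<in> marked X. length E \<ge> i}"
      then obtain A E where p: "p = (A, E)" and AE: "(A, E) \<in> marked X" "length E \<ge> i" by auto
      obtain B F where f: "f (A, E) = (B, F)" by (cases "f (A, E)")
      have st: "set (A @ E) = X" "distinct (A @ E)" "sorted E" "avoids_321 (A @ E)"
        using AE by (simp_all add: marked_def permutations_of_set_def)
      have mm: "m \<notin> set A" "m \<notin> set E" using st(1) m by auto
      have av: "avoids_321 (A @ m # E)"
        using st m by (subst avoids_321_insert_max) auto
      have av': "avoids_321 ((A @ E) @ m # [])"
        using st m by (subst avoids_321_insert_max) auto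
      have "(B, F) \<in> marked (insert m X) \<and> length F = Suc i"
      proof (cases "length E = i")
        case True
        then have "B = A" "F = E @ [m]" using f by (auto simp: f_def)
        then show ?thesis
          using st mm av' m True
          by (auto simp: marked_def permutations_of_set_def sorted_append less_imp_le)
      next
        case False
        then have BF: "B = A @ m # take (length E - Suc i) E" "F = drop (length E - Suc i) E"
          using f by (auto simp: f_def)
        then have BF_eq: "B @ F = A @ m # E" by simp
        have "B @ F \<in> permutations_of_set (insert m X)"
          unfolding BF_eq using st mm by (auto simp: permutations_of_set_def)
        moreover have "sorted F" "length F = Suc i"
          using BF(2) st False AE(2) by (simp_all add: sorted_wrt_drop)
        ultimately show ?thesis
          unfolding marked_def using av BF_eq by simp
      qed
      then show "f p \<in> {(A, E) \<in> marked (insert m X). length E = Suc i}"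
        using p f by simp
    qed
  next
    show "g ` {(A, E) \<in> marked (insert m X). length E = Suc i}
        \<subseteq> {(A, E) \<in> marked X. length E \<ge> i}"
    proof (intro image_subsetI)
      fix p assume "p \<in> {(A, E) \<in> marked (insert m X). length E = Suc i}"
      then obtain A E where p: "p = (A, E)" and AE: "(A, E) \<in> marked (insert m X)" "length E = Suc i"
        by auto
      obtain B F where g: "g (A, E) = (B, F)" by (cases "g (A, E)")
      have st: "set (A @ E) = insert m X" "distinct (A @ E)" "sorted E" "avoids_321 (A @ E)"
        using AE by (simp_all add: marked_def permutations_of_set_def)
      have mX: "m \<notin> X" using m by auto
      have "(B, F) \<in> marked X \<and> i \<le> length F"
      proof (cases "m \<in> set E")
        case True
        then obtain E' y where E': "E = E' @ [y]" by (cases E rule: rev_cases) auto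
        have "\<forall>x \<in> set (A @ E). x \<le> m" using st(1) m by (auto intro: less_imp_le)
        then have "y = m"
          using True E' st(3) by (auto simp: sorted_append intro: antisym)
        then have BF: "B = A" "F = E'" and E: "E = E' @ [m]" using g E' True by (auto simp: g_def)
        have "set (A @ E') = X" using st E mX by auto
        moreover have "avoids_321 (A @ E')"
          using st(4) by (rule avoids_321_subseq) (simp add: E subseq_append' subseq_rev_drop_many)
        ultimately show ?thesis
          using BF E AE(2) st by (auto simp: marked_def permutations_of_set_def sorted_append)
      next
        case False
        then have "m \<in> set A" using st by auto
        then obtain A1 A2 where A: "A = A1 @ m # A2" "m \<notin> set A1"
          by (meson split_list_first)
        moreover have "takeWhile (\<lambda>x. x \<noteq> m) (A1 @ m # A2) = A1"
                "dropWhile (\<lambda>x. x \<noteq> m) (A1 @ m # A2) = m # A2"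
          using \<open>m \<notin> set A1\<close> by (induction A1) auto
        ultimately have BF: "B = A1" "F = A2 @ E"
          using g False by (auto simp: g_def)
        have sX: "set (B @ F) = X" using st A BF mX by auto
        have "avoids_321 (B @ m # F)" using st(4) A BF by simp
        then have "avoids_321 (B @ F)" "sorted F"
          using sX m by (subst (asm) avoids_321_insert_max; auto)+
        then show ?thesis
          using sX st(2) A BF AE(2) by (auto simp: marked_def permutations_of_set_def)
      qed
      then show "g p \<in> {(A, E) \<in> marked X. length E \<ge> i}"
        using p g by simp
    qed
  qed
  then show ?thesis by (simp add: bij_betw_same_card)
qed

text \<open>
  A suffix of length one is always increasing, so marking the last entry or nothing is the same.
  This starts the recursion, which says nothing about empty marks.
\<close>

lemma card_marked_length_1_eq_0:
  assumes "X \<noteq> {}"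
  shows "card {(A, E) \<in> marked X. length E = 1} = card {(A, E) \<in> marked X. length E = 0}"
proof (rule bij_betw_same_card)
  show "bij_betw (\<lambda>(A, E). (A @ E, [])) {(A, E) \<in> marked X. length E = 1}
     {(A, E) \<in> marked X. length E = 0}"
  proof (rule bij_betw_byWitness[where f' = "\<lambda>(A, E). (butlast A, [last A])"])
    have "A \<noteq> []" if "(A, []) \<in> marked X" for A
      using that assms by (auto simp: marked_def permutations_of_set_def)
    then show "(\<lambda>(A, E). (butlast A, [last A])) ` {(A, E) \<in> marked X. length E = 0}
        \<subseteq> {(A, E) \<in> marked X. length E = 1}"
      and "\<forall>p \<in> {(A, E) \<in> marked X. length E = 0}.
        (\<lambda>(A, E). (A @ E, [])) ((\<lambda>(A, E). (butlast A, [last A])) p) = p"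
      by (auto simp: marked_def)
  qed (auto simp: marked_def length_Suc_conv)
qed

section \<open>The Catalan series\<close>

text \<open>
  This is \<open>z * C(z)\<close> for the generating function \<open>C\<close> of the Catalan numbers. With the extra factor
  \<open>z\<close> its powers have the ballot numbers as coefficients, and it can be composed with \<open>z / (1 - z)\<close>
  without a correcting factor.
\<close>

definition catalan_gf :: "real fps" where
  "catalan_gf = fps_const (1/2) * (1 - fps_sqrt (1 - 4 * fps_X))"

lemma fps_sqrt_square: "fps_nth f 0 = 1 \<Longrightarrow> fps_sqrt f ^ 2 = f"
  and fps_sqrt_nth_0: "fps_nth f 0 = 1 \<Longrightarrow> fps_nth (fps_sqrt f) 0 = 1"
  using fps_sqrt_unique by blast+

lemma two_fps_const_half: "2 * (fps_const (1/2) * f) = (f :: real fps)"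
proof -
  have "2 * (fps_const (1/2) * f) = fps_const (2 * (1/2)) * f"
    unfolding numeral_fps_const mult.assoc[symmetric] fps_const_mult ..
  then show ?thesis by simp
qed

lemma two_catalan_gf: "2 * catalan_gf = 1 - fps_sqrt (1 - 4 * fps_X)"
  by (simp add: catalan_gf_def two_fps_const_half)

lemma catalan_gf_nth_0: "fps_nth catalan_gf 0 = 0"
  by (simp add: catalan_gf_def fps_sqrt_nth_0)

lemma catalan_gf_square: "catalan_gf ^ 2 = catalan_gf - fps_X"
proof -
  have "(1 - 2 * catalan_gf) ^ 2 = 1 - 4 * fps_X"
    by (simp add: two_catalan_gf fps_sqrt_square)
  then have "4 * catalan_gf ^ 2 = 4 * (catalan_gf - fps_X)"
    by (simp add: power2_eq_square algebra_simps)
  then show ?thesis by (simp only: mult_cancel_left) simp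
qed

lemma catalan_gf_power_Suc: "catalan_gf ^ Suc (Suc k) = catalan_gf ^ Suc k - fps_X * catalan_gf ^ k"
proof -
  have "catalan_gf ^ Suc (Suc k) = catalan_gf ^ 2 * catalan_gf ^ k" by (simp add: power2_eq_square)
  then show ?thesis unfolding catalan_gf_square by (simp add: algebra_simps)
qed

text \<open>
  This is the recursion of \<open>card_marked_insert_max\<close> for the coefficients. With \<open>W = catalan_gf\<close>, by
  \<open>W\<^sup>2 = W - z\<close> each summand is a difference of coefficients of consecutive powers of \<open>W\<close>.
\<close>

lemma catalan_gf_power_sum:
  assumes "i \<le> Suc n"
  shows "(\<Sum>d=i..n. fps_nth (catalan_gf ^ Suc d) (Suc n)) = fps_nth (catalan_gf ^ (i + 2)) (n + 2)"
proof -
  have "(\<Sum>d=i..n. fps_nth (catalan_gf ^ Suc d) (Suc n)) =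
        (\<Sum>d=i..n. fps_nth (catalan_gf ^ (d + 2)) (n + 2)
                    - fps_nth (catalan_gf ^ (Suc d + 2)) (n + 2))"
    using catalan_gf_power_Suc by (intro sum.cong) (auto simp: numeral_2_eq_2 simp del: power_Suc)
  also have "\<dots> = fps_nth (catalan_gf ^ (i + 2)) (n + 2) - fps_nth (catalan_gf ^ (Suc n + 2)) (n + 2)"
    using sum_Suc_diff[OF assms, of "\<lambda>d. - fps_nth (catalan_gf ^ (d + 2)) (n + 2)"] by simp
  also have "fps_nth (catalan_gf ^ (Suc n + 2)) (n + 2) = 0"
    by (rule startsby_zero_power_prefix[OF catalan_gf_nth_0, rule_format]) simp
  finally show ?thesis by simp
qed

section \<open>Counting marked permutations and splits\<close>

lemma card_marked_ge:
  assumes "card X = n"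
  shows "card {(A, E) \<in> marked X. length E \<ge> i} = (\<Sum>d=i..n. card {(A, E) \<in> marked X. length E = d})"
proof -
  have "{(A, E) \<in> marked X. length E \<ge> i} = (\<Union>d\<in>{i..n}. {(A, E) \<in> marked X. length E = d})"
    using assms length_marked by fastforce
  also have "card \<dots> = (\<Sum>d=i..n. card {(A, E) \<in> marked X. length E = d})"
    by (rule card_UN_disjoint) (auto intro: finite_subset[OF _ finite_marked])
  finally show ?thesis .
qed

text \<open>
  Both sides satisfy the same recursion under insertion of a new maximum; for the empty mark the
  two sides agree with those for \<open>j = 1\<close>, since \<open>W = catalan_gf\<close> and \<open>W\<^sup>2\<close> differ
  only in the coefficient of \<open>z\<close>.
\<close>

lemma card_marked_eq_coeff:
  assumes "finite X"
  shows "real (card {(A, E) \<in> marked X. length E = j}) = fps_nth (catalan_gf ^ Suc j) (Suc (card X))"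
  using assms
proof (induction X arbitrary: j rule: finite_linorder_max_induct)
  case empty
  have "avoids_321 []" by (simp add: avoids_321_def)
  then have "{(A, E) \<in> marked {}. length E = j} = (if j = 0 then {([], [])} else {})"
    by (auto simp: marked_def)
  moreover have "fps_nth catalan_gf 1 = 1"
    using arg_cong[OF catalan_gf_square, of "\<lambda>f. fps_nth f 1"]
    by (simp add: power2_eq_square fps_mult_nth catalan_gf_nth_0)
  moreover have "fps_nth (catalan_gf ^ Suc j) 1 = 0" if "j > 0"
    using that by (intro startsby_zero_power_prefix[OF catalan_gf_nth_0, rule_format]) simp
  ultimately show ?case by (simp del: power_Suc) 
next
  case (insert m X)
  define n where "n = card X"
  have n: "card (insert m X) = Suc n"
    using insert by (auto simp: n_def)
  have step: "real (card {(A, E) \<in> marked (insert m X). length E = Suc i})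
      = fps_nth (catalan_gf ^ (i + 2)) (n + 2)" for i
  proof -
    have "real (card {(A, E) \<in> marked (insert m X). length E = Suc i}) =
        (\<Sum>d=i..n. fps_nth (catalan_gf ^ Suc d) (Suc n))"
      using insert by (simp add: card_marked_insert_max card_marked_ge[OF n_def[symmetric]] n_def)
    also have "\<dots> = fps_nth (catalan_gf ^ (i + 2)) (n + 2)"
    proof (cases "i \<le> Suc n")
      case False
      then show ?thesis 
        using startsby_zero_power_prefix[OF catalan_gf_nth_0, of "i+2"] by simp
    qed (rule catalan_gf_power_sum)
    finally show ?thesis .
  qed
  show ?case
  proof (cases j)
    case 0
    then show ?thesis
      using step[of 0] card_marked_length_1_eq_0[of "insert m X"] n catalan_gf_square
      by (simp add: numeral_2_eq_2)
  next
    case (Suc i)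
    then show ?thesis using step[of i] n by simp
  qed
qed

lemma card_avoiders_eq_coeff:
  assumes "finite X"
  shows "real (card {\<pi> \<in> permutations_of_set X. avoids_321 \<pi>}) = fps_nth catalan_gf (Suc (card X))"
proof -
  have "{(A, E) \<in> marked X. length E = 0} =
     (\<lambda>\<pi>. (\<pi>, [])) ` {\<pi> \<in> permutations_of_set X. avoids_321 \<pi>}"
    by (auto simp: marked_def)
  then have "card {(A, E) \<in> marked X. length E = 0} = card {\<pi> \<in> permutations_of_set X. avoids_321 \<pi>}"
    by (simp add: card_image inj_on_def)
  then show ?thesis using card_marked_eq_coeff[OF assms, of 0] by simp
qed

text \<open>A split is determined by its prefix, because the suffix lists the other values in order.\<close>

lemma card_splits_eq_sum:
  assumes "finite X"
  shows "card (splits X) = (\<Sum>S\<in>Pow X. card {\<pi> \<in> permutations_of_set S. avoids_321 \<pi>})"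
proof -
  let ?P = "\<lambda>S. {\<pi> \<in> permutations_of_set S. avoids_321 \<pi>}"
  let ?f = "\<lambda>S A. (A, sorted_list_of_set (X - S))"
  have "splits X = (\<Union>S\<in>Pow X. ?f S ` ?P S)"
  proof (intro equalityI subsetI)
    fix p assume "p \<in> splits X"
    then obtain A B where p: "p = (A, B)" and st: "set A \<union> set B = X" "distinct A" "distinct B"
      "set A \<inter> set B = {}" "sorted B" "avoids_321 A"
      by (auto simp: splits_def permutations_of_set_def)
    have "B = sorted_list_of_set (X - set A)"
    proof -
      have "X - set A = set B" using st by auto
      then show ?thesis using st by (simp add: sorted_list_of_set.idem_if_sorted_distinct)
    qed
    then show "p \<in> (\<Union>S\<in>Pow X. ?f S ` ?P S)"
      using p st by (auto simp: permutations_of_set_def)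
  next
    fix p assume "p \<in> (\<Union>S\<in>Pow X. ?f S ` ?P S)"
    then show "p \<in> splits X"
      using assms by (auto simp: splits_def permutations_of_set_def intro: finite_subset)
  qed
  also have "card \<dots> = (\<Sum>S\<in>Pow X. card (?f S ` ?P S))"
    using assms by (intro card_UN_disjoint ballI impI finite_imageI
      finite_subset[OF Collect_restrict finite_permutations_of_set])
      (auto simp: permutations_of_set_def)
  also have "\<dots> = (\<Sum>S\<in>Pow X. card (?P S))"
    by (intro sum.cong refl card_image) (auto simp: inj_on_def)
  finally show ?thesis .
qed

lemma sum_Pow_card:
  fixes f :: "nat \<Rightarrow> 'b :: comm_semiring_1"
  assumes "finite X"
  shows "(\<Sum>S\<in>Pow X. f (card S)) = (\<Sum>k=0..card X. of_nat (card X choose k) * f k)"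
proof -
  have "(\<Sum>S\<in>Pow X. f (card S)) = (\<Sum>k=0..card X. \<Sum>S | S \<in> Pow X \<and> card S = k. f (card S))"
    using assms by (intro sum.group[symmetric]) (auto intro: card_mono)
  also have "\<dots> = (\<Sum>k=0..card X. of_nat (card X choose k) * f k)"
    using n_subsets[OF assms] by (intro sum.cong) auto
  finally show ?thesis .
qed

text \<open>
  Substituting \<open>z / (1 - z)\<close> into a series with constant term 0 performs the binomial transform on
  the sequence of its coefficients from index 1 on. So this is \<open>z\<close> times the generating function of
  the splits.
\<close>

definition split_gf :: "real fps" where
  "split_gf = catalan_gf oo (fps_X * inverse (1 - fps_X))"

lemma split_gf_nth_Suc:
  "fps_nth split_gf (Suc n) = (\<Sum>k=0..n. of_nat (n choose k) * fps_nth catalan_gf (Suc k))"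
proof -
  have pw: "fps_nth ((fps_X * inverse (1 - fps_X :: real fps)) ^ Suc k) (Suc n) = of_nat (n choose k)"
    if "k \<le> n" for k
  proof -
    have "inverse (1 - fps_X :: real fps) ^ Suc k = Abs_fps (\<lambda>l. of_nat ((k + l) choose l))"
      using one_minus_const_fps_X_neg_power'[of "Suc k" "1 :: real"]
      by (simp add: fps_inverse_power del: power_Suc)
    then have "fps_nth ((fps_X * inverse (1 - fps_X :: real fps)) ^ Suc k) (Suc n) =
       of_nat (n choose (n - k))"
      using that by (simp add: power_mult_distrib fps_X_power_mult_nth del: power_Suc)
    then show ?thesis using binomial_symmetric[OF that] by simp
  qed
  have "fps_nth split_gf (Suc n) = (\<Sum>k=0..n. fps_nth catalan_gf (Suc k) *
      fps_nth ((fps_X * inverse (1 - fps_X)) ^ Suc k) (Suc n))"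
    unfolding split_gf_def fps_compose_nth sum.atLeast0_atMost_Suc_shift
    by (simp add: catalan_gf_nth_0 del: power_Suc)
  then show ?thesis
    by (simp add: pw mult.commute del: power_Suc)
qed

lemma two_split_gf: "2 * split_gf = 1 - fps_sqrt (1 - 5 * fps_X) / fps_sqrt (1 - fps_X)"
proof -
  define P :: "real fps" where "P = inverse (1 - fps_X)"
  let ?q = "fps_sqrt (1 - 5 * fps_X) / fps_sqrt (1 - fps_X)"
  have P: "(1 - fps_X) * P = 1" by (simp add: P_def inverse_mult_eq_1')
  have "split_gf ^ 2 = split_gf - fps_X * P"
    unfolding split_gf_def P_def
    by (simp add: fps_compose_power catalan_gf_square fps_compose_sub_distrib fps_X_fps_compose_startby0)
  moreover have "(1 - 2 * split_gf) ^ 2 = 1 - 4 * (split_gf - split_gf ^ 2)"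
    by (simp add: power2_eq_square algebra_simps)
  ultimately have "(1 - 2 * split_gf) ^ 2 = 1 - 4 * (fps_X * P)"
    by simp
  also have "\<dots> = (1 - 5 * fps_X) * P"
    using P by (simp add: algebra_simps)
  finally have V2: "(1 - 2 * split_gf) ^ 2 = (1 - 5 * fps_X) * P" .
  have "?q ^ 2 = (1 - 5 * fps_X) * P"
    by (simp add: fps_divide_unit power_mult_distrib fps_sqrt_nth_0 fps_sqrt_square P_def
        fps_inverse_power[symmetric])
  moreover have "fps_nth ?q 0 = 1"
    by (simp add: fps_divide_unit fps_sqrt_nth_0)
  moreover have "fps_nth (1 - 2 * split_gf) 0 = 1"
    by (simp add: split_gf_def catalan_gf_nth_0)
  moreover have "fps_nth ((1 - 5 * fps_X) * P) 0 = 1"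
    by (simp add: P_def)
  ultimately have "1 - 2 * split_gf = ?q"
    using V2 fps_sqrt_unique by metis
  then show ?thesis by (simp add: algebra_simps)
qed

lemma card_splits_eq_coeff:
  assumes "finite X"
  shows "real (card (splits X)) = fps_nth split_gf (Suc (card X))"
proof -
  have "real (card (splits X)) = (\<Sum>S\<in>Pow X. fps_nth catalan_gf (Suc (card S)))"
    unfolding card_splits_eq_sum[OF assms] of_nat_sum
    using assms by (intro sum.cong refl card_avoiders_eq_coeff) (auto intro: finite_subset)
  then show ?thesis
    using sum_Pow_card[OF assms, of "\<lambda>k. fps_nth catalan_gf (Suc k)"] by (simp add: split_gf_nth_Suc)
qed

lemma card_marked_nonempty:
  assumes "finite X"
  shows "real (card {(A, E) \<in> marked X. E \<noteq> []}) = fps_nth (catalan_gf ^ 3) (card X + 2)"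
proof -
  have "{(A, E) \<in> marked X. E \<noteq> []} = {(A, E) \<in> marked X. length E \<ge> 1}"
    by (auto simp: Suc_le_eq)
  also have "real (card \<dots>) = (\<Sum>d=1..card X. fps_nth (catalan_gf ^ Suc d) (Suc (card X)))"
    unfolding card_marked_ge[OF refl] of_nat_sum card_marked_eq_coeff[OF assms] ..
  also have "\<dots> = fps_nth (catalan_gf ^ (1 + 2)) (card X + 2)"
    by (rule catalan_gf_power_sum) simp
  finally show ?thesis by (simp add: eval_nat_numeral)
qed

section \<open>Permutations versus splits\<close>

text \<open>
  Each permutation of the class has exactly one split whose prefix cannot be extended by the next
  entry: pattern avoidance passes to prefixes, so a prefix that cannot be extended is the longest.
  The splits that can be extended are those with a nonempty marked suffix of a \<open>321\<close>-avoider.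
\<close>

lemma class_count_eq:
  "class_count (Av_juxt [3, 2, 1] [2, 1]) n + card {(A, E) \<in> marked {1..n}. E \<noteq> []} =
   card (splits {1..n})"
proof -
  let ?C = "{\<pi> \<in> Av_juxt [3, 2, 1] [2, 1]. length \<pi> = n}"
  define latest where "latest = {(A, B) \<in> splits {1..n}. B \<noteq> [] \<longrightarrow> \<not> avoids_321 (A @ [hd B])}"
  have C_eq: "?C = {A @ B |A B. (A, B) \<in> splits {1..n}}"
  proof -
    have "length \<pi> = n" if "\<pi> \<in> permutations_of_set {1..n}" for \<pi>
      using length_finite_permutations_of_set[OF that] by simp
    then show ?thesis
      unfolding Av_juxt_def splits_def avoids_21_iff_sorted avoids_321_iff by blast
  qed
  have split: "splits {1..n} = latest \<union> {(A, E) \<in> marked {1..n}. E \<noteq> []}"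
  proof (intro equalityI subsetI)
    fix p assume p: "p \<in> splits {1..n}"
    obtain A B where [simp]: "p = (A, B)" by (cases p)
    show "p \<in> latest \<union> {(A, E) \<in> marked {1..n}. E \<noteq> []}"
    proof (cases B)
      case (Cons x B')
      then show ?thesis
        using p avoids_321_append_increasing[of A x B']
        by (auto simp: latest_def splits_def marked_def)
    qed (use p in \<open>simp add: latest_def\<close>)
  qed (use marked_subset_splits in \<open>auto simp: latest_def\<close>)
  have "latest \<inter> {(A, E) \<in> marked {1..n}. E \<noteq> []} = {}"
  proof -
    have "avoids_321 (A @ [hd E])" if "avoids_321 (A @ E)" "E \<noteq> []" for A E
      using that(1) by (rule avoids_321_subseq) (use that(2) in \<open>cases E; simp add: subseq_append'\<close>)
    then show ?thesis by (fastforce simp: latest_def marked_def)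
  qed
  then have card: "card (splits {1..n}) = card latest + card {(A, E) \<in> marked {1..n}. E \<noteq> []}"
    unfolding split
    by (intro card_Un_disjoint) (auto simp: latest_def
        intro: finite_subset[OF _ finite_splits] finite_subset[OF _ finite_marked])
  have longest: "length A' \<le> length A"
    if pre: "(A, B) \<in> latest" "(A', B') \<in> latest" "A @ B = A' @ B'" for A B A' B'
  proof (rule ccontr)
    assume "\<not> length A' \<le> length A"
    then obtain us where us: "A' = A @ us" "B = us @ B'" "us \<noteq> []"
      using pre(3) by (auto simp: append_eq_append_conv2)
    then have "subseq (A @ [hd B]) A'"
      by (cases us) (auto simp: subseq_append')
    moreover have "avoids_321 A'"
      using pre(2) by (simp add: latest_def splits_def)
    ultimately have "avoids_321 (A @ [hd B])"
      by (rule avoids_321_subseq[rotated])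
    then show False using pre(1) us by (auto simp: latest_def)
  qed
  have "bij_betw (\<lambda>(A, B). A @ B) latest ?C"
    unfolding bij_betw_def
  proof
    show "inj_on (\<lambda>(A, B). A @ B) latest"
    proof (rule inj_onI, clarify)
      fix A B A' B' assume "(A, B) \<in> latest" "(A', B') \<in> latest" "A @ B = A' @ B'"
      moreover from this have "length A = length A'"
        using longest by (metis le_antisym)
      ultimately show "A = A' \<and> B = B'" by simp
    qed
    show "(\<lambda>(A, B). A @ B) ` latest = ?C"
    proof (intro equalityI subsetI)
      fix \<pi> assume "\<pi> \<in> ?C"
      then obtain A B where "(A, B) \<in> splits {1..n}" "\<pi> = A @ B" unfolding C_eq by blast
      then show "\<pi> \<in> (\<lambda>(A, B). A @ B) ` latest"
      proof (induction B arbitrary: A)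
        case Nil
        then show ?case by (force simp: latest_def)
      next
        case (Cons x B)
        show ?case
        proof (cases "avoids_321 (A @ [x])")
          case True
          then have "(A @ [x], B) \<in> splits {1..n}" using Cons.prems by (auto simp: splits_def)
          then show ?thesis using Cons.IH[of "A @ [x]"] Cons.prems by simp
        next
          case False
          then show ?thesis using Cons.prems by (force simp: latest_def)
        qed
      qed
    next
      fix \<pi> assume "\<pi> \<in> (\<lambda>(A, B). A @ B) ` latest"
      then obtain A B where "(A, B) \<in> latest" and \<pi>: "\<pi> = A @ B" by (auto elim!: imageE)
      then have "(A, B) \<in> splits {1..n}" by (simp add: latest_def)
      then show "\<pi> \<in> ?C" unfolding C_eq \<pi> by blast
    qed
  qed
  then have "card latest = class_count (Av_juxt [3, 2, 1] [2, 1]) n"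
    unfolding class_count_def by (rule bij_betw_same_card)
  with card show ?thesis by simp
qed

theorem theorem2:
  shows "class_gf (Av_juxt [3, 2, 1] [2, 1]) =
    - ((1 - fps_sqrt (1 - 4 * fps_X)
        + fps_X * (- 4 + fps_sqrt (1 - 4 * fps_X)
                   + fps_sqrt (1 - 5 * fps_X) / fps_sqrt (1 - fps_X)))
       / (2 * fps_X ^ 2))" (is "?s = - (?N / _)")
proof -
  have coeff: "fps_nth ?s n = fps_nth split_gf (Suc n) - fps_nth (catalan_gf ^ 3) (n + 2)" for n
    using arg_cong[OF class_count_eq[of n], of real]
      card_splits_eq_coeff[of "{1..n}"] card_marked_nonempty[of "{1..n}"]
    by (simp add: class_gf_def)
  have "fps_X ^ 2 * ?s = fps_X * split_gf - catalan_gf ^ 3"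
  proof (rule fps_ext)
    fix n :: nat
    \<comment> \<open>The coefficient formula starts at \<open>z\<^sup>2\<close>; the terms of lower order vanish on both sides.\<close>
    have "fps_nth (catalan_gf ^ 3) k = 0" if "k < 3" for k
      using startsby_zero_power_prefix[OF catalan_gf_nth_0] that by blast
    moreover have "fps_nth split_gf 0 = 0" by (simp add: split_gf_def catalan_gf_nth_0)
    moreover have "n = 0 \<or> n = 1 \<or> (\<exists>k. n = k + 2)"
      using nat_le_iff_add[of 2 n] by (auto simp: add.commute not_le numeral_2_eq_2 less_Suc_eq)
    ultimately show "fps_nth (fps_X ^ 2 * ?s) n = fps_nth (fps_X * split_gf - catalan_gf ^ 3) n"
      by (auto simp: coeff[unfolded One_nat_def] fps_X_power_mult_nth)
  qed
  moreover have "catalan_gf ^ 3 = catalan_gf - fps_X - fps_X * catalan_gf"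
    using catalan_gf_power_Suc[of 1] catalan_gf_square by (simp add: eval_nat_numeral)
  ultimately have "fps_X ^ 2 * ?s = fps_X * split_gf - catalan_gf + fps_X + fps_X * catalan_gf"
    by simp
  then have "2 * (fps_X ^ 2 * ?s) = 2 * (fps_X * split_gf - catalan_gf + fps_X + fps_X * catalan_gf)"
    by (rule arg_cong)
  then have "2 * fps_X ^ 2 * ?s =
      fps_X * (2 * split_gf) - 2 * catalan_gf + 2 * fps_X + fps_X * (2 * catalan_gf)"
    by (simp add: algebra_simps)
  also have "\<dots> = - ?N"
    unfolding two_split_gf two_catalan_gf by (simp add: algebra_simps)
  finally have "?N = 2 * fps_X ^ 2 * (- ?s)"
    by (simp add: algebra_simps)
  then have "?N / (2 * fps_X ^ 2) = - ?s"
    by (simp only:) (rule nonzero_mult_div_cancel_left, simp)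
  then show ?thesis by simp
qed

end
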